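(* Let $U\subseteq\mathbb{M}\mathbb{C}(n)$ be open with $U\neq\varnothing$ and let $S\subseteq\mathbb{F}_2^n$ be a subset of odd vectors. Then the following statements are equivalent. (i) $\displaystyle\mathrm{Hol}(U)=\bigcap_{\vec{s}\in S}\mathrm{Hol}_{\mathbf{i}^{\vec{s}}}(U)$. (ii) $\mathrm{span}\,S=\mathbb{F}_2^n$ (linear span over $\mathbb{F}_2$).
   Context: Let $n\ge1$. The multicomplex numbers are defined recursively by $\mathbb{M}\mathbb{C}(0)=\mathbb{R}$ and $\mathbb{M}\mathbb{C}(n)=\{\eta_1+\eta_2\mathbf{i}_n:\eta_1,\eta_2\in\mathbb{M}\mathbb{C}(n-1)\}$ with $\mathbf{i}_n^2=-1$, where $\mathbf{i}_n$ is a new formal square root of $-1$ commuting with everything. Thus $\mathbb{M}\mathbb{C}(n)$ is a commutative unital real algebra of dimension $2^n$ generated by commuting units $\mathbf{i}_1,\dots,\mathbf{i}_n$ with $\mathbf{i}_k^2=-1$. For $\vec{b}=(b_1,\dots,b_n)^\top\in\mathbb{F}_2^n$ put $\mathbf{i}^{\vec{b}}:=\mathbf{i}_1^{b_1}\cdots\mathbf{i}_n^{b_n}$; these $2^n$ monomials form a real basis, denoted $\mathbb{I}(n)$. A vector $\vec{b}\in\mathbb{F}_2^n$ is odd if $\sum_k b_k\equiv1\pmod 2$; equivalently $(\mathbf{i}^{\vec{b}})^2=-1$. "Class $C^1$" means continuously differentiable as a map between real vector spaces, and $DF(\eta)$ is the real differential at $\eta$. $\mathrm{Hol}(U)$ (multicomplex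 holomorphic functions) is the set of $C^1$ functions $F:U\to\mathbb{M}\mathbb{C}(n)$ such that for every $\eta\in U$ there is $\lambda(\eta)\in\mathbb{M}\mathbb{C}(n)$ with $DF(\eta)[h]=\lambda(\eta)h$ for all $h\in\mathbb{M}\mathbb{C}(n)$. For $\mathbf{i}\in\mathbb{I}(n)$ with $\mathbf{i}^2=-1$, let $\mathcal{L}_{\mathbf{i}}(\eta)=\mathbf{i}\eta$; $\mathrm{Hol}_{\mathbf{i}}(U)$ ($\mathbf{i}$-holomorphic functions) is the set of $C^1$ functions $F:U\to\mathbb{M}\mathbb{C}(n)$ with $DF(\eta)\circ\mathcal{L}_{\mathbf{i}}=\mathcal{L}_{\mathbf{i}}\circ DF(\eta)$ for every $\eta\in U$. The intersection is taken among $C^1$ functions $U\to\mathbb{M}\mathbb{C}(n)$, so that for $S=\varnothing$ it is the set of all such functions. *)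

theory Defs
  imports "HOL-Analysis.Analysis" "HOL-Library.Z2"
begin

section \<open>The algebra of multicomplex numbers\<close>

text \<open>
  The units $i_k$ are indexed by a finite type \<open>'n\<close>, so that
  \<open>'n multicomplex\<close> is $MC(n)$ for $n$ the cardinality of \<open>'n\<close>.
  An element is its family of real coordinates in the basis of the monomials
  $i^b$, $b \in F_2^n$.  Since the units commute and square to $-1$,
  $i^a i^b = (-1)^{m} i^{a+b}$, where $m$ is the number of $k$ with $a_k = b_k = 1$.
  That this is the recursively defined algebra is shown below
  (\<^verbatim>\<open>multicomplex_base\<close>, \<^verbatim>\<open>multicomplex_step\<close>).
\<close>

instance bit :: finite
proof
  have "(UNIV :: bit set) = {0, 1}"
    using bit_not_zero_iff by blast
  then show "finite (UNIV :: bit set)"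
    by (metis finite.emptyI finite.insertI)
qed

typedef (overloaded) 'n multicomplex = "UNIV :: (bit ^ 'n \<Rightarrow> real) set"
  morphisms mc_coeff Abs_mc ..

setup_lifting type_definition_multicomplex

lemma mc_eq_iff: "x = y \<longleftrightarrow> (\<forall>b. mc_coeff x b = mc_coeff y b)"
  by (metis ext mc_coeff_inject)

definition mc_sign :: "bit ^ 'n \<Rightarrow> bit ^ 'n \<Rightarrow> real"
  where "mc_sign a b = (\<Prod>k\<in>UNIV. if a $ k = 1 \<and> b $ k = 1 then - 1 else 1)"

lemma mc_sign_commute: "mc_sign a b = mc_sign b a"
  by (simp add: mc_sign_def conj_commute)

lemma mc_sign_add_right: "mc_sign a (b + c) = mc_sign a b * mc_sign a c"
  unfolding mc_sign_def prod.distrib[symmetric]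
proof (rule prod.cong[OF refl])
  fix k
  show "(if a $ k = 1 \<and> (b + c) $ k = 1 then - 1 else 1 :: real) =
        (if a $ k = 1 \<and> b $ k = 1 then - 1 else 1) * (if a $ k = 1 \<and> c $ k = 1 then - 1 else 1)"
    by (cases "b $ k"; cases "c $ k") auto
qed

lemma mc_sign_add_left: "mc_sign (a + b) c = mc_sign a c * mc_sign b c"
  by (metis mc_sign_commute mc_sign_add_right)

lemma mc_sign_0 [simp]: "mc_sign 0 b = 1" "mc_sign b 0 = 1"
  by (simp_all add: mc_sign_def)

lemma bitvec_minus_eq_plus: "(a :: bit ^ 'n) - b = a + b"
  by (simp add: vec_eq_iff)

lemma bitvec_add_self: "(a :: bit ^ 'n) + a = 0"
  using bitvec_minus_eq_plus[of a a] by simp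

instantiation multicomplex :: (finite) real_vector
begin

lift_definition zero_multicomplex :: "'a multicomplex" is "\<lambda>b. 0" .
lift_definition plus_multicomplex :: "'a multicomplex \<Rightarrow> 'a multicomplex \<Rightarrow> 'a multicomplex"
  is "\<lambda>x y b. x b + y b" .
lift_definition uminus_multicomplex :: "'a multicomplex \<Rightarrow> 'a multicomplex"
  is "\<lambda>x b. - x b" .
lift_definition minus_multicomplex :: "'a multicomplex \<Rightarrow> 'a multicomplex \<Rightarrow> 'a multicomplex"
  is "\<lambda>x y b. x b - y b" .
lift_definition scaleR_multicomplex :: "real \<Rightarrow> 'a multicomplex \<Rightarrow> 'a multicomplex"
  is "\<lambda>r x b. r * x b" .

instance
  by standard (transfer; simp add: fun_eq_iff algebra_simps)+

end

lemmas mc_coeff_vector [simp] = zero_multicomplex.rep_eq plus_multicomplex.rep_eq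
  uminus_multicomplex.rep_eq minus_multicomplex.rep_eq scaleR_multicomplex.rep_eq

lemma mc_coeff_sum [simp]: "mc_coeff (sum f A) b = (\<Sum>i\<in>A. mc_coeff (f i) b)"
  by (induction A rule: infinite_finite_induct) simp_all

instantiation multicomplex :: (finite) comm_ring_1
begin

lift_definition one_multicomplex :: "'a multicomplex" is "\<lambda>b. if b = 0 then 1 else 0" .

lift_definition times_multicomplex :: "'a multicomplex \<Rightarrow> 'a multicomplex \<Rightarrow> 'a multicomplex"
  is "\<lambda>x y c. \<Sum>a\<in>UNIV. mc_sign a (c - a) * x a * y (c - a)" .

instance
proof
  fix x y z :: "'a multicomplex"
  have shift: "bij ((+) b)" for b :: "bit ^ 'a"
    by (simp add: bij_plus_right)
  have reind: "(\<Sum>a\<in>UNIV. f a) = (\<Sum>a\<in>UNIV. f (b + a))" for f :: "bit ^ 'a \<Rightarrow> real" and b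
    using sum.reindex_bij_betw[OF shift[of b], of f] by simp
  have cancel: "b + (b + a) = a" for a b :: "bit ^ 'a"
    by (metis add.assoc add_0 bitvec_add_self)
  show comm: "x * y = y * x"
    unfolding mc_eq_iff times_multicomplex.rep_eq bitvec_minus_eq_plus
  proof
    fix c
    show "(\<Sum>a\<in>UNIV. mc_sign a (c + a) * mc_coeff x a * mc_coeff y (c + a)) =
          (\<Sum>a\<in>UNIV. mc_sign a (c + a) * mc_coeff y a * mc_coeff x (c + a))"
      by (subst reind[where b = c]) (simp add: cancel mc_sign_commute mult_ac)
  qed
  show "x * y * z = x * (y * z)"
    unfolding mc_eq_iff times_multicomplex.rep_eq bitvec_minus_eq_plus
  proof
    fix d
    have "(\<Sum>c\<in>UNIV. mc_sign c (d + c) *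
              (\<Sum>a\<in>UNIV. mc_sign a (c + a) * mc_coeff x a * mc_coeff y (c + a)) * mc_coeff z (d + c))
        = (\<Sum>c\<in>UNIV. \<Sum>a\<in>UNIV. mc_sign c (d + c) * mc_sign a (c + a) * mc_coeff x a *
              mc_coeff y (c + a) * mc_coeff z (d + c))"
      by (simp add: sum_distrib_left sum_distrib_right mult_ac)
    also have "\<dots> = (\<Sum>a\<in>UNIV. \<Sum>c\<in>UNIV. mc_sign c (d + c) * mc_sign a (c + a) * mc_coeff x a *
              mc_coeff y (c + a) * mc_coeff z (d + c))"
      by (rule sum.swap)
    also have "\<dots> = (\<Sum>a\<in>UNIV. \<Sum>b\<in>UNIV. mc_sign (a + b) (d + (a + b)) * mc_sign a b * mc_coeff x a *
              mc_coeff y b * mc_coeff z (d + (a + b)))"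
    proof (rule sum.cong[OF refl])
      fix a :: "bit ^ 'a"
      have cancel': "a + b + a = b" for b
        by (metis add.commute cancel)
      show "(\<Sum>c\<in>UNIV. mc_sign c (d + c) * mc_sign a (c + a) * mc_coeff x a *
              mc_coeff y (c + a) * mc_coeff z (d + c)) =
            (\<Sum>b\<in>UNIV. mc_sign (a + b) (d + (a + b)) * mc_sign a b * mc_coeff x a *
              mc_coeff y b * mc_coeff z (d + (a + b)))"
        by (subst reind[where b = a]) (simp only: cancel')
    qed
    also have "\<dots> = (\<Sum>a\<in>UNIV. \<Sum>b\<in>UNIV. mc_sign a (d + a) * mc_sign b (d + a + b) * mc_coeff x a *
              mc_coeff y b * mc_coeff z (d + a + b))"
    proof (intro sum.cong refl)
      fix a b :: "bit ^ 'a"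
      have sq: "mc_sign a b * mc_sign a b = 1"
        by (metis bitvec_add_self mc_sign_0(2) mc_sign_add_right)
      have "mc_sign (a + b) (d + (a + b)) * mc_sign a b = mc_sign a (d + a) * mc_sign b (d + a + b)"
        using sq by (simp add: mc_sign_add_left mc_sign_add_right algebra_simps)
      then show "mc_sign (a + b) (d + (a + b)) * mc_sign a b * mc_coeff x a *
              mc_coeff y b * mc_coeff z (d + (a + b)) = mc_sign a (d + a) * mc_sign b (d + a + b) * mc_coeff x a *
              mc_coeff y b * mc_coeff z (d + a + b)"
        by (simp add: add.assoc)
    qed
    finally show "(\<Sum>c\<in>UNIV. mc_sign c (d + c) *
              (\<Sum>a\<in>UNIV. mc_sign a (c + a) * mc_coeff x a * mc_coeff y (c + a)) * mc_coeff z (d + c))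
        = (\<Sum>a\<in>UNIV. mc_sign a (d + a) * mc_coeff x a *
              (\<Sum>b\<in>UNIV. mc_sign b (d + a + b) * mc_coeff y b * mc_coeff z (d + a + b)))"
      by (simp add: sum_distrib_left mult_ac)
  qed
  show "1 * x = x"
    by (simp add: mc_eq_iff times_multicomplex.rep_eq one_multicomplex.rep_eq
        if_distrib[of "\<lambda>t. _ * t"] if_distrib[of "\<lambda>t. t * _"] cong: if_cong)
  show "(x + y) * z = x * z + y * z"
    by (simp add: mc_eq_iff times_multicomplex.rep_eq sum.distrib algebra_simps)
  show "(0 :: 'a multicomplex) \<noteq> 1"
    by (auto simp: mc_eq_iff one_multicomplex.rep_eq)
qed

end

instance multicomplex :: (finite) real_algebra_1
proof
  fix x y :: "'a multicomplex" and r :: real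
  show left: "r *\<^sub>R x * y = r *\<^sub>R (x * y)" for x y :: "'a multicomplex"
    unfolding mc_eq_iff times_multicomplex.rep_eq mc_coeff_vector
    by (simp add: sum_distrib_left mult_ac)
  show "x * r *\<^sub>R y = r *\<^sub>R (x * y)"
    using left[of y x] by (metis mult.commute)
qed

text \<open>
  The norm is the Euclidean one with respect to the monomial basis; it is only used to give
  the finite-dimensional space its usual topology and differential calculus.
\<close>

definition mc_base :: "bit ^ 'n \<Rightarrow> 'n multicomplex"
  where "mc_base b = Abs_mc (\<lambda>c. if c = b then 1 else 0)"

lemma mc_coeff_base [simp]: "mc_coeff (mc_base b) c = (if c = b then 1 else 0)"
  by (simp add: mc_base_def Abs_mc_inverse)

instantiation multicomplex :: (finite) euclidean_space
begin

definition inner_multicomplex :: "'a multicomplex \<Rightarrow> 'a multicomplex \<Rightarrow> real"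
  where "inner x y = (\<Sum>b\<in>UNIV. mc_coeff x b * mc_coeff y b)"

definition norm_multicomplex :: "'a multicomplex \<Rightarrow> real"
  where "norm x = sqrt (\<Sum>b\<in>UNIV. mc_coeff x b * mc_coeff x b)"

definition sgn_multicomplex :: "'a multicomplex \<Rightarrow> 'a multicomplex"
  where "sgn (x :: 'a multicomplex) = x /\<^sub>R norm x"

definition dist_multicomplex :: "'a multicomplex \<Rightarrow> 'a multicomplex \<Rightarrow> real"
  where "dist (x :: 'a multicomplex) y = norm (x - y)"

definition uniformity_multicomplex :: "('a multicomplex \<times> 'a multicomplex) filter"
  where "uniformity_multicomplex = (INF e\<in>{0 <..}. principal {(x, y). dist x y < e})"

definition open_multicomplex :: "'a multicomplex set \<Rightarrow> bool"
  where "open_multicomplex U \<longleftrightarrow> (\<forall>x\<in>U. eventually (\<lambda>(x', y). x' = x \<longrightarrow> y \<in> U) uniformity)"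

definition Basis_multicomplex :: "'a multicomplex set"
  where "Basis_multicomplex = range mc_base"

instance
proof
  fix x y z u v :: "'a multicomplex" and r :: real and U :: "'a multicomplex set"
  have inner_base: "inner w (mc_base b) = mc_coeff w b" for w :: "'a multicomplex" and b
    by (simp add: inner_multicomplex_def if_distrib[of "\<lambda>t. _ * t"] cong: if_cong)
  show "sgn x = x /\<^sub>R norm x"
    by (rule sgn_multicomplex_def)
  show "dist x y = norm (x - y)"
    by (rule dist_multicomplex_def)
  show "uniformity = (INF e\<in>{0 <..}. principal {(x :: 'a multicomplex, y). dist x y < e})"
    by (rule uniformity_multicomplex_def)
  show "open U \<longleftrightarrow> (\<forall>x\<in>U. eventually (\<lambda>(x', y). x' = x \<longrightarrow> y \<in> U) uniformity)"
    by (rule open_multicomplex_def)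
  show "inner x y = inner y x"
    by (simp add: inner_multicomplex_def mult.commute)
  show "inner (x + y) z = inner x z + inner y z"
    by (simp add: inner_multicomplex_def sum.distrib algebra_simps)
  show "inner (r *\<^sub>R x) y = r * inner x y"
    by (simp add: inner_multicomplex_def sum_distrib_left mult_ac)
  show "0 \<le> inner x x"
    by (simp add: inner_multicomplex_def sum_nonneg)
  show "inner x x = 0 \<longleftrightarrow> x = 0"
    by (simp add: inner_multicomplex_def mc_eq_iff sum_nonneg_eq_0_iff)
  show "norm x = sqrt (inner x x)"
    by (simp add: norm_multicomplex_def inner_multicomplex_def)
  show "(Basis :: 'a multicomplex set) \<noteq> {}" "finite (Basis :: 'a multicomplex set)"
    by (simp_all add: Basis_multicomplex_def)
  show "inner u v = (if u = v then 1 else 0)" if uv: "u \<in> Basis" "v \<in> Basis"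
  proof -
    obtain a b where "u = mc_base a" "v = mc_base b"
      using uv unfolding Basis_multicomplex_def by blast
    moreover have "mc_base a = mc_base b \<longleftrightarrow> a = b"
      by (auto simp: mc_eq_iff)
    ultimately show ?thesis
      by (simp add: inner_base)
  qed
  show "(\<forall>u\<in>Basis. inner x u = 0) \<longleftrightarrow> x = 0"
    by (simp add: Basis_multicomplex_def inner_base mc_eq_iff)
qed

end

section \<open>Units and monomials\<close>

definition mc_unit :: "'n \<Rightarrow> 'n::finite multicomplex"
  where "mc_unit k = mc_base (axis k 1)"

definition mc_monomial :: "bit ^ 'n \<Rightarrow> 'n::finite multicomplex"
  where "mc_monomial b = (\<Prod>k | b $ k = 1. mc_unit k)"

definition odd_vec :: "bit ^ 'n \<Rightarrow> bool"
  where "odd_vec b \<longleftrightarrow> (\<Sum>k\<in>UNIV. b $ k) = 1"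

lemma mc_one_eq: "1 = mc_base 0"
  by (simp add: mc_eq_iff one_multicomplex.rep_eq)

lemma mc_base_mult: "mc_base a * mc_base b = mc_sign a b *\<^sub>R mc_base (a + b)"
proof -
  have "mc_coeff (mc_base a * mc_base b) c = mc_coeff (mc_sign a b *\<^sub>R mc_base (a + b)) c" for c
  proof -
    have "mc_coeff (mc_base a * mc_base b) c =
        (\<Sum>d\<in>UNIV. if d = a then mc_sign a (c - a) * mc_coeff (mc_base b) (c - a) else 0)"
      unfolding times_multicomplex.rep_eq by (rule sum.cong) simp_all
    also have "\<dots> = mc_sign a (c - a) * mc_coeff (mc_base b) (c - a)"
      by (subst sum.delta) simp_all
    also have "\<dots> = mc_coeff (mc_sign a b *\<^sub>R mc_base (a + b)) c"
    proof (cases "c = a + b")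
      case False
      then have "c - a \<noteq> b"
        by (metis add_diff_cancel_left' diff_add_cancel add.commute)
      with False show ?thesis
        by simp
    qed simp
    finally show ?thesis .
  qed
  then show ?thesis
    unfolding mc_eq_iff by blast
qed

lemma mc_unit_square: "mc_unit k * mc_unit k = - 1"
proof -
  have "mc_sign (axis k 1) (axis k 1) = (\<Prod>j\<in>UNIV. if j = k then - 1 else 1)"
    unfolding mc_sign_def by (rule prod.cong) (auto simp: axis_def)
  also have "\<dots> = - 1"
    by (subst prod.delta) simp_all
  finally have sign: "mc_sign (axis k 1) (axis k 1) = - 1" .
  have "mc_unit k * mc_unit k = (- 1) *\<^sub>R mc_base 0"
    unfolding mc_unit_def mc_base_mult sign bitvec_add_self ..
  then show ?thesis
    by (simp flip: mc_one_eq)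
qed

lemma mc_monomial_eq_base: "mc_monomial b = mc_base b"
proof -
  have all: "(\<Prod>k\<in>A. mc_unit k) = mc_base (\<chi> k. if k \<in> A then 1 else 0)" for A :: "'a set"
  proof (induction A rule: infinite_finite_induct)
    case (infinite A)
    then show ?case
      using finite[of A] by contradiction
  next
    case empty
    have "(\<chi> k. if k \<in> {} then 1 else 0) = (0 :: bit ^ 'a)"
      by (simp add: vec_eq_iff)
    then show ?case
      by (simp only: mc_one_eq prod.empty)
  next
    case (insert j A)
    let ?v = "(\<chi> k. if k \<in> A then 1 else 0) :: bit ^ 'a"
    have "mc_sign (axis j 1) ?v = 1"
      unfolding mc_sign_def by (rule prod.neutral) (use insert(2) in \<open>simp add: axis_def\<close>)
    moreover have "axis j 1 + ?v = (\<chi> k. if k \<in> insert j A then 1 else 0)"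
      using insert(2) by (simp add: vec_eq_iff axis_def)
    ultimately have "mc_unit j * mc_base ?v = mc_base (\<chi> k. if k \<in> insert j A then 1 else 0)"
      by (simp only: mc_unit_def mc_base_mult scaleR_one)
    then show ?case
      by (simp only: prod.insert[OF insert(1,2)] insert(3))
  qed
  have "(\<chi> k. if k \<in> {k. b $ k = 1} then 1 else 0) = b"
    by (simp add: vec_eq_iff)
  then show ?thesis
    using all[of "{k. b $ k = 1}"] by (metis mc_monomial_def)
qed

lemma Basis_eq_monomials: "(Basis :: 'n::finite multicomplex set) = range mc_monomial"
  by (simp add: Basis_multicomplex_def mc_monomial_eq_base)

lemma odd_vec_iff_square: "odd_vec b \<longleftrightarrow> mc_monomial b * mc_monomial b = - 1"
proof -
  have "(\<Prod>k\<in>A. if b $ k = 1 \<and> b $ k = 1 then - 1 else 1 :: real) =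
      (if (\<Sum>k\<in>A. b $ k) = 1 then - 1 else 1)" if "finite A" for A
    using that
  proof (induction A)
    case (insert j A)
    then show ?case
      by (cases "b $ j"; cases "\<Sum>k\<in>A. b $ k") simp_all
  qed simp
  from this[OF finite_class.finite_UNIV]
  have "mc_sign b b = (if odd_vec b then - 1 else 1)"
    by (simp only: mc_sign_def odd_vec_def)
  then have sq: "mc_monomial b * mc_monomial b = (if odd_vec b then - 1 else 1)"
    by (simp only: mc_monomial_eq_base mc_base_mult bitvec_add_self mc_one_eq[symmetric]
        scaleR_minus1_left scaleR_one split: if_split) simp
  have "mc_coeff (1 :: 'a multicomplex) 0 \<noteq> mc_coeff (- 1) 0"
    by (simp add: one_multicomplex.rep_eq)
  then have "(1 :: 'a multicomplex) \<noteq> - 1"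
    by metis
  then show ?thesis
    using sq by (simp split: if_splits)
qed

section \<open>The recursive construction\<close>

text \<open>
  $MC(1) = R + R i_1$, and $MC(n+1) = MC(n) + MC(n) i_{n+1}$, where the new index is
  \<^term>\<open>None :: 'n option\<close> and $MC(n)$ is embedded by \<open>mc_embed\<close>, a homomorphism of
  unital real algebras taking units to units.
\<close>

lemma multicomplex_base:
  assumes "CARD('n::finite) = 1"
  shows "bij (\<lambda>(r, s). of_real r + of_real s * mc_unit (k :: 'n))"
proof -
  have univ: "(UNIV :: 'n set) = {k}"
    using assms by (metis UNIV_I card_1_singletonE singletonD)
  have vecs: "b = 0 \<or> b = axis k 1" for b :: "bit ^ 'n"
  proof (cases "b $ k = 0")
    case True
    then have "b $ j = 0" for j
      using univ by (metis UNIV_I singletonD)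
    then show ?thesis by (simp add: vec_eq_iff)
  next
    case False
    then have "b $ j = axis k 1 $ j" for j
      using univ by (metis UNIV_I singletonD axis_nth bit_not_zero_iff)
    then show ?thesis by (simp add: vec_eq_iff)
  qed
  have ne: "axis k 1 \<noteq> (0 :: bit ^ 'n)"
    by (simp add: vec_eq_iff axis_def)
  have coeff: "mc_coeff (of_real r + of_real s * mc_unit k) b = (if b = 0 then r else s)" for r s b
    using vecs[of b] ne by (auto simp: of_real_def mc_unit_def one_multicomplex.rep_eq)
  show ?thesis
  proof (rule bijI)
    show "inj (\<lambda>(r, s). of_real r + of_real s * mc_unit k)"
    proof (rule injI, clarify)
      fix r s r' s' :: real
      assume "of_real r + of_real s * mc_unit k = of_real r' + of_real s' * mc_unit k"
      then have "(if b = 0 then r else s) = (if b = 0 then r' else s')" for b :: "bit ^ 'n"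
        by (metis coeff)
      from this[of 0] this[of "axis k 1"] ne show "r = r' \<and> s = s'"
        by simp
    qed
    show "surj (\<lambda>(r, s). of_real r + of_real s * mc_unit k)"
    proof (rule surjI)
      fix x :: "'n multicomplex"
      show "(\<lambda>(r, s). of_real r + of_real s * mc_unit k) (mc_coeff x 0, mc_coeff x (axis k 1)) = x"
        unfolding mc_eq_iff prod.case coeff using vecs ne by metis
    qed
  qed
qed

definition mc_embed :: "'n::finite multicomplex \<Rightarrow> 'n option multicomplex"
  where "mc_embed x = Abs_mc (\<lambda>b. if b $ None = 0 then mc_coeff x (\<chi> k. b $ Some k) else 0)"

definition vec_extend :: "bit \<Rightarrow> bit ^ 'n \<Rightarrow> bit ^ ('n::finite option)"
  where "vec_extend t b = (\<chi> k. case k of None \<Rightarrow> t | Some j \<Rightarrow> b $ j)"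

lemma mc_coeff_embed [simp]:
  "mc_coeff (mc_embed x) b = (if b $ None = 0 then mc_coeff x (\<chi> k. b $ Some k) else 0)"
  by (simp add: mc_embed_def Abs_mc_inverse)

lemma vec_extend_eq_iff: "c = vec_extend t b \<longleftrightarrow> c $ None = t \<and> b = (\<chi> k. c $ Some k)"
  by (auto simp: vec_extend_def vec_eq_iff split: option.splits)

lemma vec_extend_add: "vec_extend s a + vec_extend t b = vec_extend (s + t) (a + b)"
  by (auto simp: vec_extend_def vec_eq_iff split: option.splits)

lemma axis_None_eq: "axis None 1 = vec_extend 1 0"
  by (simp add: vec_extend_eq_iff) (simp add: axis_def vec_eq_iff)

lemma axis_Some_eq: "axis (Some k) 1 = vec_extend 0 (axis k 1)"
  by (simp add: vec_extend_eq_iff) (simp add: axis_def vec_eq_iff)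

lemma mc_sign_extend: "mc_sign (vec_extend 0 a) (vec_extend t b) = mc_sign a b"
proof -
  have "(\<Prod>k\<in>UNIV. f k) = f None * (\<Prod>k\<in>UNIV. f (Some k))" for f :: "'a option \<Rightarrow> real"
    by (simp add: UNIV_option_conv prod.reindex)
  then show ?thesis
    by (simp add: mc_sign_def vec_extend_def)
qed

lemma mc_expand: "x = (\<Sum>b\<in>UNIV. mc_coeff x b *\<^sub>R mc_base b)"
  by (simp add: mc_eq_iff if_distrib[of "\<lambda>t. _ * t"] cong: if_cong)

lemma mc_embed_base: "mc_embed (mc_base b) = mc_base (vec_extend 0 b)"
  by (auto simp: mc_eq_iff vec_extend_eq_iff)

lemma mc_embed_add: "mc_embed (x + y) = mc_embed x + mc_embed y"
  by (simp add: mc_eq_iff)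

lemma mc_embed_scaleR: "mc_embed (r *\<^sub>R x) = r *\<^sub>R mc_embed x"
  by (simp add: mc_eq_iff)

lemma mc_embed_sum: "mc_embed (sum f A) = (\<Sum>i\<in>A. mc_embed (f i))"
  by (simp add: mc_eq_iff)

lemma mc_embed_expand: "mc_embed x = (\<Sum>b\<in>UNIV. mc_coeff x b *\<^sub>R mc_base (vec_extend 0 b))"
  by (subst mc_expand[of x]) (simp only: mc_embed_sum mc_embed_scaleR mc_embed_base)

lemma mc_embed_mult: "mc_embed (x * y) = mc_embed x * mc_embed y"
proof -
  have "mc_embed (x * y) = mc_embed (\<Sum>a\<in>UNIV. \<Sum>b\<in>UNIV. (mc_coeff y b * (mc_coeff x a * mc_sign a b)) *\<^sub>R mc_base (a + b))"
    by (subst mc_expand[of x], subst mc_expand[of y])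
       (simp add: sum_product mc_base_mult mult.assoc)
  also have "\<dots> = (\<Sum>a\<in>UNIV. \<Sum>b\<in>UNIV. (mc_coeff y b * (mc_coeff x a * mc_sign a b)) *\<^sub>R mc_base (vec_extend 0 (a + b)))"
    by (simp only: mc_embed_sum mc_embed_scaleR mc_embed_base)
  also have "\<dots> = mc_embed x * mc_embed y"
    unfolding mc_embed_expand
    by (simp add: sum_product mc_base_mult mc_sign_extend vec_extend_add mult.assoc)
  finally show ?thesis .
qed

lemma mc_coeff_embed_unit:
  "mc_coeff (mc_embed y * mc_unit None) c = (if c $ None = 1 then mc_coeff y (\<chi> k. c $ Some k) else 0)"
proof -
  have "mc_embed y * mc_unit None = (\<Sum>b\<in>UNIV. mc_coeff y b *\<^sub>R mc_base (vec_extend 1 b))"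
    unfolding mc_embed_expand mc_unit_def axis_None_eq
    by (simp add: sum_distrib_right mc_base_mult mc_sign_extend vec_extend_add)
  then show ?thesis
    by (simp add: vec_extend_eq_iff if_distrib[of "\<lambda>t. _ * t"] cong: if_cong)
qed

theorem multicomplex_step:
  fixes x y :: "'n::finite multicomplex"
  shows "mc_embed (x + y) = mc_embed x + mc_embed y"
    and "mc_embed (x * y) = mc_embed x * mc_embed y"
    and "mc_embed (r *\<^sub>R x) = r *\<^sub>R mc_embed x"
    and "mc_embed (1 :: 'n multicomplex) = 1"
    and "mc_embed (mc_unit k) = mc_unit (Some k)"
    and "bij (\<lambda>(x, y). mc_embed (x :: 'n multicomplex) + mc_embed y * mc_unit None)"
proof -
  show "mc_embed (1 :: 'n multicomplex) = 1"
  proof -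
    have "vec_extend 0 0 = (0 :: bit ^ 'n option)"
      using vec_extend_eq_iff[of 0 0 0] by (simp add: vec_eq_iff)
    then show ?thesis
      by (simp add: mc_one_eq mc_embed_base)
  qed
  show "mc_embed (mc_unit k) = mc_unit (Some k)"
    by (simp add: mc_unit_def mc_embed_base axis_Some_eq)
  have ext: "vec_extend t b $ None = t" "(\<chi> k. vec_extend t b $ Some k) = b" for t and b :: "bit ^ 'n"
    by (simp_all add: vec_extend_def vec_eq_iff)
  show "bij (\<lambda>(x, y). mc_embed (x :: 'n multicomplex) + mc_embed y * mc_unit None)"
  proof (rule bijI)
    show "inj (\<lambda>(x, y). mc_embed (x :: 'n multicomplex) + mc_embed y * mc_unit None)"
    proof (rule injI, clarify)
      fix x y x' y' :: "'n multicomplex"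
      assume "mc_embed x + mc_embed y * mc_unit None = mc_embed x' + mc_embed y' * mc_unit None"
      then have eq: "mc_coeff (mc_embed x + mc_embed y * mc_unit None) (vec_extend t b)
          = mc_coeff (mc_embed x' + mc_embed y' * mc_unit None) (vec_extend t b)" for t b
        by simp
      show "x = x' \<and> y = y'"
        using eq[of 0] eq[of 1] by (simp add: mc_coeff_embed_unit ext mc_eq_iff)
    qed
    show "surj (\<lambda>(x, y). mc_embed (x :: 'n multicomplex) + mc_embed y * mc_unit None)"
    proof (rule surjI)
      fix z :: "'n option multicomplex"
      have recon: "vec_extend (c $ None) (\<chi> k. c $ Some k) = c" for c :: "bit ^ 'n option"
        using vec_extend_eq_iff by metis
      show "(\<lambda>(x, y). mc_embed (x :: 'n multicomplex) + mc_embed y * mc_unit None)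
          (Abs_mc (\<lambda>b. mc_coeff z (vec_extend 0 b)), Abs_mc (\<lambda>b. mc_coeff z (vec_extend 1 b))) = z"
        unfolding mc_eq_iff prod.case
      proof
        fix c :: "bit ^ 'n option"
        show "mc_coeff (mc_embed (Abs_mc (\<lambda>b. mc_coeff z (vec_extend 0 b))) +
            mc_embed (Abs_mc (\<lambda>b. mc_coeff z (vec_extend 1 b))) * mc_unit None) c = mc_coeff z c"
          using recon[of c] by (cases "c $ None") (simp_all add: mc_coeff_embed_unit Abs_mc_inverse)
      qed
    qed
  qed
qed (fact mc_embed_add mc_embed_mult mc_embed_scaleR)+

section \<open>Holomorphic functions\<close>

text \<open>
  Functions on \<open>U\<close> are total functions that are extensional on \<open>U\<close>,
  so that equality of sets of functions only concerns their values on \<open>U\<close>.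
  All notions are meant for open \<open>U\<close>.
\<close>

definition C1 :: "'a::euclidean_space set \<Rightarrow> ('a \<Rightarrow> 'a) set"
  where "C1 U = {F \<in> extensional U. \<exists>F' :: 'a \<Rightarrow> 'a \<Rightarrow>\<^sub>L 'a.
    (\<forall>x\<in>U. (F has_derivative blinfun_apply (F' x)) (at x)) \<and> continuous_on U F'}"

definition Hol :: "'n::finite multicomplex set \<Rightarrow> ('n multicomplex \<Rightarrow> 'n multicomplex) set"
  where "Hol U = {F \<in> C1 U. \<forall>x\<in>U. \<exists>c. \<forall>h. frechet_derivative F (at x) h = c * h}"

definition Hol_unit ::
    "'n::finite multicomplex \<Rightarrow> 'n multicomplex set \<Rightarrow> ('n multicomplex \<Rightarrow> 'n multicomplex) set"
  where "Hol_unit i U = {F \<in> C1 U. \<forall>x\<in>U.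
    frechet_derivative F (at x) \<circ> (*) i = (*) i \<circ> frechet_derivative F (at x)}"

end

theory Submission
  imports Defs
begin

text \<open>
  Both directions are statements about real linear maps \<open>D\<close> on the algebra, which are then applied
  to differentials.

  Since $i^a i^b = \pm i^{a+b}$, the vectors \<open>b\<close> for which \<open>D\<close> commutes with multiplication by
  $i^b$ form a linear subspace of $F_2^n$.  If \<open>D\<close> commutes with the monomials indexed by a spanning
  set, it therefore commutes with all monomials, so $D(i^b) = i^b D(1)$, and as the monomials
  are a real basis \<open>D\<close> is multiplication by $D(1)$.

  If \<open>W\<close>, the span of \<open>S\<close>, is a proper subspace, the coordinate projection onto the
  real span of the $i^b$ with $b \in W$ commutes with $i^s$ for every $s \in S$, because translation
  by \<open>s\<close> preserves both \<open>W\<close> and its complement.  It fixes \<open>1\<close> but annihilates $i^b$ for $b \notin W$,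
  so it is not multiplication by any element.  This linear map, restricted to \<open>U\<close>, separates the two
  classes of functions at every point of \<open>U\<close>.
\<close>

text \<open>
  The sign in $i^a i^b = \pm i^{a+b}$ is a nonzero real scalar, so it can be cancelled from
  the commutation relation for $i^a i^b$.
\<close>

lemma commute_mc_base_add:
  assumes "linear D"
    and a: "\<And>h. D (mc_base a * h) = mc_base a * D h"
    and b: "\<And>h. D (mc_base b * h) = mc_base b * D h"
  shows "D (mc_base (a + b) * h) = mc_base (a + b) * D h"
proof -
  interpret D: linear D by fact
  have "mc_sign a b * mc_sign a b = 1"
    by (metis bitvec_add_self mc_sign_0(2) mc_sign_add_right)
  then have base: "mc_base (a + b) = mc_sign a b *\<^sub>R (mc_base a * mc_base b)"
    by (simp add: mc_base_mult)
  show ?thesis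
    unfolding base by (simp add: D.scale a b mult.assoc)
qed

lemma commute_mc_base_span:
  assumes lin: "linear D"
    and S: "\<And>s h. s \<in> S \<Longrightarrow> D (mc_base s * h) = mc_base s * D h"
    and b: "b \<in> vec.span S"
  shows "D (mc_base b * h) = mc_base b * D h"
proof -
  let ?V = "{b. \<forall>h. D (mc_base b * h) = mc_base b * D h}"
  have "vec.subspace ?V"
  proof (rule vec.subspaceI)
    show zero: "0 \<in> ?V"
      by (simp flip: mc_one_eq)
    show "a + b \<in> ?V" if "a \<in> ?V" "b \<in> ?V" for a b
      using that by (simp add: commute_mc_base_add[OF lin])
    show "t *s a \<in> ?V" if "a \<in> ?V" for t a
      using that zero by (cases t) simp_all
  qed
  moreover have "S \<subseteq> ?V"
    using S by blast
  ultimately have "vec.span S \<subseteq> ?V"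
    by (intro vec.span_minimal)
  with b have "b \<in> ?V" by (rule rev_subsetD)
  then show ?thesis by simp
qed

lemma linear_eq_mult_if_commute_all:
  assumes "linear D" and all: "\<And>b h. D (mc_base b * h) = mc_base b * D h"
  shows "D h = D 1 * h"
proof -
  interpret D: linear D by fact
  have base: "D (mc_base b) = D 1 * mc_base b" for b
    using all[of b 1] by (simp add: mult.commute)
  have "D h = (\<Sum>b\<in>UNIV. mc_coeff h b *\<^sub>R D (mc_base b))"
    by (subst mc_expand[of h]) (simp add: D.sum D.scale)
  also have "\<dots> = D 1 * (\<Sum>b\<in>UNIV. mc_coeff h b *\<^sub>R mc_base b)"
    by (simp add: base sum_distrib_left)
  finally show ?thesis
    by (simp flip: mc_expand)
qed

definition mc_proj :: "(bit ^ 'n) set \<Rightarrow> 'n multicomplex \<Rightarrow> 'n multicomplex"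
  where "mc_proj W x = Abs_mc (\<lambda>b. if b \<in> W then mc_coeff x b else 0)"

lemma mc_coeff_proj [simp]: "mc_coeff (mc_proj W x) b = (if b \<in> W then mc_coeff x b else 0)"
  by (simp add: mc_proj_def Abs_mc_inverse)

lemma linear_mc_proj: "linear (mc_proj W :: 'n::finite multicomplex \<Rightarrow> 'n multicomplex)"
  by (rule linearI) (simp_all add: mc_eq_iff)

lemma mc_coeff_base_mult:
  "mc_coeff (mc_base s * x) c = mc_sign s (c - s) * mc_coeff x (c - s)"
proof -
  have "mc_coeff (mc_base s * x) c =
      (\<Sum>d\<in>UNIV. if d = s then mc_sign s (c - s) * mc_coeff x (c - s) else 0)"
    unfolding times_multicomplex.rep_eq by (rule sum.cong) simp_all
  then show ?thesis by simp
qed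

text \<open>
  Multiplication by $i^s$ permutes the coordinates, up to sign, by translation by \<open>s\<close>; for
  \<open>s\<close> in the subspace this leaves the set of retained coordinates invariant.
\<close>

lemma mc_proj_base_mult:
  assumes W: "vec.subspace W" and s: "s \<in> W"
  shows "mc_proj W (mc_base s * x) = mc_base s * mc_proj W x"
proof -
  have "c - s \<in> W \<longleftrightarrow> c \<in> W" for c
    using vec.subspace_add[OF W, of "c - s" s] vec.subspace_diff[OF W, of c s] s by auto
  then show ?thesis
    by (simp add: mc_eq_iff mc_coeff_base_mult)
qed

lemma mc_proj_not_mult:
  assumes "0 \<in> W" and b: "b \<notin> W"
  shows "\<not> (\<forall>h. mc_proj W h = c * h)"
proof
  assume eq: "\<forall>h. mc_proj W h = c * h"
  have "mc_proj W 1 = 1"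
    using assms(1) by (simp add: mc_eq_iff one_multicomplex.rep_eq)
  with eq have "c = 1" by (metis mult.right_neutral)
  with eq have "mc_coeff (mc_proj W (mc_base b)) b = mc_coeff (mc_base b) b"
    by simp
  with b show False by simp
qed

lemma C1_linear_frechet_derivative:
  assumes "F \<in> C1 U" and "x \<in> U"
  shows "linear (frechet_derivative F (at x))"
proof -
  have "F differentiable (at x)"
    using assms unfolding C1_def differentiable_def by blast
  then show ?thesis by (rule linear_frechet_derivative)
qed

lemma Hol_unit_monomial_iff:
  "F \<in> Hol_unit (mc_monomial s) U \<longleftrightarrow> F \<in> C1 U \<and>
    (\<forall>x\<in>U. \<forall>h. frechet_derivative F (at x) (mc_base s * h)
               = mc_base s * frechet_derivative F (at x) h)"
  by (auto simp: Hol_unit_def mc_monomial_eq_base fun_eq_iff)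

lemma Hol_subset_Hol_unit: "Hol U \<subseteq> Hol_unit i U"
proof
  fix F assume F: "F \<in> Hol U"
  have "frechet_derivative F (at x) \<circ> (*) i = (*) i \<circ> frechet_derivative F (at x)"
    if x: "x \<in> U" for x
  proof -
    obtain c where "\<And>h. frechet_derivative F (at x) h = c * h"
      using F x unfolding Hol_def by blast
    then show ?thesis by (simp add: fun_eq_iff mult.left_commute)
  qed
  with F show "F \<in> Hol_unit i U"
    by (simp add: Hol_def Hol_unit_def)
qed

lemma frechet_derivative_restrict_linear:
  fixes D :: "'a::euclidean_space \<Rightarrow> 'a"
  assumes "linear D" and "open U" and "x \<in> U"
  shows "(restrict D U has_derivative D) (at x)"
    and "frechet_derivative (restrict D U) (at x) = D"
proof -
  have "(D has_derivative D) (at x)"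
    using assms(1) by (simp add: bounded_linear_imp_has_derivative linear_conv_bounded_linear)
  then show der: "(restrict D U has_derivative D) (at x)"
    by (rule has_derivative_transform_within_open[OF _ assms(2,3)]) simp
  show "frechet_derivative (restrict D U) (at x) = D"
    using frechet_derivative_at[OF der] by simp
qed

lemma restrict_linear_C1:
  fixes D :: "'a::euclidean_space \<Rightarrow> 'a"
  assumes "linear D" and "open U"
  shows "restrict D U \<in> C1 U"
proof -
  have "blinfun_apply (Blinfun D) = D"
    using assms(1) by (simp add: bounded_linear_Blinfun_apply linear_conv_bounded_linear)
  with frechet_derivative_restrict_linear(1)[OF assms] show ?thesis
    unfolding C1_def by (auto intro!: exI[of _ "\<lambda>_. Blinfun D"])
qed

theorem theorem4p7:
  fixes U :: "'n::finite multicomplex set" and S :: "(bit ^ 'n) set"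
  assumes "open U" and "U \<noteq> {}" and "\<And>s. s \<in> S \<Longrightarrow> odd_vec s"
  shows "Hol U = C1 U \<inter> (\<Inter>s\<in>S. Hol_unit (mc_monomial s) U) \<longleftrightarrow> vec.span S = UNIV"
proof
  assume eq: "Hol U = C1 U \<inter> (\<Inter>s\<in>S. Hol_unit (mc_monomial s) U)"
  show "vec.span S = UNIV"
  proof (rule ccontr)
    assume "vec.span S \<noteq> UNIV"
    then obtain b where b: "b \<notin> vec.span S" by blast
    let ?D = "mc_proj (vec.span S)" and ?F = "restrict (mc_proj (vec.span S)) U"
    note D = linear_mc_proj[of "vec.span S"]
    note der = frechet_derivative_restrict_linear(2)[OF D \<open>open U\<close>]
    have "?F \<in> C1 U"
      by (rule restrict_linear_C1[OF D \<open>open U\<close>])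
    moreover have "?D (mc_base s * h) = mc_base s * ?D h" if "s \<in> S" for s h
      using that by (simp add: mc_proj_base_mult vec.subspace_span vec.span_base)
    ultimately have "?F \<in> C1 U \<inter> (\<Inter>s\<in>S. Hol_unit (mc_monomial s) U)"
      by (simp add: Hol_unit_monomial_iff der)
    with eq have "?F \<in> Hol U" by simp
    moreover obtain x where "x \<in> U"
      using \<open>U \<noteq> {}\<close> by blast
    ultimately obtain c where "\<forall>h. ?D h = c * h"
      unfolding Hol_def using der by auto
    then show False
      using mc_proj_not_mult[OF vec.span_zero b] by blast
  qed
next
  assume span: "vec.span S = UNIV"
  show "Hol U = C1 U \<inter> (\<Inter>s\<in>S. Hol_unit (mc_monomial s) U)"
  proof
    show "Hol U \<subseteq> C1 U \<inter> (\<Inter>s\<in>S. Hol_unit (mc_monomial s) U)"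
      using Hol_subset_Hol_unit by (auto simp: Hol_def)
    show "C1 U \<inter> (\<Inter>s\<in>S. Hol_unit (mc_monomial s) U) \<subseteq> Hol U"
    proof
      fix F assume F: "F \<in> C1 U \<inter> (\<Inter>s\<in>S. Hol_unit (mc_monomial s) U)"
      have "\<exists>c. \<forall>h. frechet_derivative F (at x) h = c * h" if x: "x \<in> U" for x
      proof -
        let ?D = "frechet_derivative F (at x)"
        have lin: "linear ?D"
          using F x by (blast intro: C1_linear_frechet_derivative)
        have "?D (mc_base s * h) = mc_base s * ?D h" if "s \<in> S" for s h
          using F x that by (simp add: Hol_unit_monomial_iff)
        then have "?D (mc_base b * h) = mc_base b * ?D h" for b h
          by (rule commute_mc_base_span[OF lin]) (use span in auto)
        then show ?thesis
          by (intro exI allI) (rule linear_eq_mult_if_commute_all[OF lin])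
      qed
      with F show "F \<in> Hol U"
        by (simp add: Hol_def)
    qed
  qed
qed

end
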